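(* Let $p\ge 2$ and $m\ge 1$ be integers, let $A\in\mathcal{M}_1$, i.e. $A$ is a nonsingular $M$-matrix whose diagonal entries are all in $(0,1]$, and let $\{X_k\}_{k\ge 0}$ be generated by Schröder's method for $A^{1/p}$. Then $X_k\in\mathcal{M}_1$ for all $k\ge 0$.
   Context: A real square matrix $A$ is a nonsingular $M$-matrix if $A=sI-N$ with $N\ge 0$ entrywise and $s>\rho(N)$, where $\rho$ is the spectral radius. $\mathcal{M}_1$ is the set of all nonsingular $M$-matrices whose diagonal entries are in $(0,1]$. $A^{1/p}$ denotes the principal $p$th root of $A$. For real $x$ and integer $i\ge 0$, $(x)_i=x(x+1)\cdots(x+i-1)$, with $(x)_0=1$. Let $b_0=1$, $b_i=\frac{(-1/p)_i}{i!}$ for $i\ge 1$ (the coefficients in $(1-t)^{1/p}=\sum_{i\ge 0} b_i t^i$), and $T_m(t)=\sum_{i=0}^m b_i t^i$. Schröder's method (with parameter $m$) for $A^{1/p}$ is the iteration $X_0=I$, $X_{k+1}=X_k\,T_m(R(X_k))$ with $R(X_k)=I-AX_k^{-p}$, for $k\ge 0$ (for the matrices $A$ considered here all $X_k$ are nonsingular, so the sequence is well defined). *)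

theory Defs
  imports "Jordan_Normal_Form.Spectral_Radius"
begin

definition nonsingular_M_matrix :: "nat \<Rightarrow> real mat \<Rightarrow> bool" where
  "nonsingular_M_matrix n A \<longleftrightarrow>
     (\<exists>s N. N \<in> carrier_mat n n \<and> 0\<^sub>m n n \<le> N \<and>
        A = s \<cdot>\<^sub>m 1\<^sub>m n - N \<and> spectral_radius (map_mat complex_of_real N) < s)"

definition M1 :: "nat \<Rightarrow> real mat set" where
  "M1 n = {A. nonsingular_M_matrix n A \<and> (\<forall>i<n. 0 < A $$ (i, i) \<and> A $$ (i, i) \<le> 1)}"

definition schroeder_coeff :: "nat \<Rightarrow> nat \<Rightarrow> real" where
  "schroeder_coeff p i = pochhammer (- (1 / real p)) i / fact i"

definition schroeder_T :: "nat \<Rightarrow> nat \<Rightarrow> real mat \<Rightarrow> real mat" where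
  "schroeder_T p m M = mat (dim_row M) (dim_row M)
     (\<lambda>(r, c). \<Sum>i\<le>m. schroeder_coeff p i * (M ^\<^sub>m i) $$ (r, c))"

(* the (mat_inverse X) is the inverse when X is invertible, and unspecified otherwise. *)
definition schroeder_R :: "nat \<Rightarrow> real mat \<Rightarrow> real mat \<Rightarrow> real mat" where
  "schroeder_R p A X = 1\<^sub>m (dim_row A) - A * (the (mat_inverse X) ^\<^sub>m p)"

primrec schroeder_iter :: "nat \<Rightarrow> nat \<Rightarrow> real mat \<Rightarrow> nat \<Rightarrow> real mat" where
  "schroeder_iter p m A 0 = 1\<^sub>m (dim_row A)"
| "schroeder_iter p m A (Suc k) =
     schroeder_iter p m A k * schroeder_T p m (schroeder_R p A (schroeder_iter p m A k))"

(* Iterates in M1 n are invertible, so the unspecified inverse in schroeder_R does not arise for them. *)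
lemma nonsingular_M_matrix_inverse:
  assumes M: "nonsingular_M_matrix n A" and n: "n \<ge> 1"
  obtains B where "B \<in> carrier_mat n n" "mat_inverse A = Some B" "A * B = 1\<^sub>m n" "B * A = 1\<^sub>m n"
proof -
  obtain s N where N: "N \<in> carrier_mat n n" and A: "A = s \<cdot>\<^sub>m 1\<^sub>m n - N"
    and s: "spectral_radius (map_mat complex_of_real N) < s"
    using M unfolding nonsingular_M_matrix_def by blast
  let ?N = "map_mat complex_of_real N"
  have cN: "?N \<in> carrier_mat n n" and cA: "A \<in> carrier_mat n n"
    using N A by auto
  have "det A \<noteq> 0"
  proof
    assume 0: "det A = 0"
    have eq: "char_matrix ?N (complex_of_real s) = (- 1) \<cdot>\<^sub>m map_mat complex_of_real A"
      unfolding A char_matrix_def using N by (intro eq_matI) auto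
    have "det (map_mat complex_of_real A) = 0"
      using 0 of_real_hom.hom_det[of A] by simp
    then have "eigenvalue ?N (complex_of_real s)"
      unfolding eigenvalue_det[OF cN] eq det_smult by simp
    then have "norm (complex_of_real s) \<le> spectral_radius ?N"
      using n by (intro spectral_radius_mem_max(2)[OF cN] imageI) (simp_all add: spectrum_def)
    then show False using s by simp
  qed
  then have U: "A \<in> Units (ring_mat TYPE(real) n ())"
    by (rule det_non_zero_imp_unit[OF cA])
  then obtain B where "mat_inverse A = Some B"
    using mat_inverse(1)[OF cA, where b = "()"] by (cases "mat_inverse A") auto
  with mat_inverse(2)[OF cA] that show thesis by blast
qed

end

theory Submission
  imports Defs "HOL-Computational_Algebra.Formal_Power_Series"
begin

text \<open>
  Put B = I - A X^(-p), f(t) = 1 - (1 - t) T(t)^(-p) and h = T f. One step replaces X by X T(B) and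
  B by f(B). The differential equation T + p (1 - t) T' = d t^m with d \<ge> 0 gives
  f' = d t^m T^(-p-1) and p h' = p T' + T^(1-p) + (p - 1) d t^m T^(-p). The first shows that h
  vanishes to order m + 1; since T' has degree below m and 1/T has nonnegative coefficients, the
  second then shows that h has nonnegative coefficients, and so has f = h / T. Hence X B \<ge> 0 is
  preserved, which together with I - T(B) being a nonnegative combination of positive powers of B
  yields X T(B) \<le> X \<le> I. As the inverse of X is a product of matrices (1/T)(B) \<ge> 0, X is a
  nonsingular M-matrix.

  All series involved have absolutely summable coefficients and f(1) = 1, so they can be evaluated
  at any matrix with bounded powers, and f(B) has bounded powers again.
\<close>

section \<open>Nonnegative matrices and M-matrices\<close>

lemma mat_nonneg_iff:
  "A \<in> carrier_mat n n \<Longrightarrow>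
    0\<^sub>m n n \<le> A \<longleftrightarrow> (\<forall>r<n. \<forall>c<n. 0 \<le> A $$ (r, c))"
  by (auto simp: less_eq_mat_def)

lemma mat_nonnegD:
  "0\<^sub>m n n \<le> A \<Longrightarrow> r < n \<Longrightarrow> c < n \<Longrightarrow> 0 \<le> A $$ (r, c)"
  by (auto simp: less_eq_mat_def)

lemma mult_mat_nth:
  "\<lbrakk>A \<in> carrier_mat n n; B \<in> carrier_mat n n; r < n; c < n\<rbrakk> \<Longrightarrow>
    (A * B) $$ (r, c) = (\<Sum>l<n. A $$ (r, l) * B $$ (l, c))"
  by (auto simp: scalar_prod_def atLeast0LessThan)

lemma mult_mat_nonneg:
  fixes A B :: "real mat"
  assumes "A \<in> carrier_mat n n" "B \<in> carrier_mat n n" "0\<^sub>m n n \<le> A" "0\<^sub>m n n \<le> B"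
  shows "0\<^sub>m n n \<le> A * B"
  using assms by (subst mat_nonneg_iff) (auto simp: mat_nonneg_iff mult_mat_nth simp del: index_mult_mat(1) intro!: sum_nonneg)

lemma one_mat_nonneg: "0\<^sub>m n n \<le> (1\<^sub>m n :: real mat)"
  by (auto simp: less_eq_mat_def)

lemma pow_mat_nonneg:
  fixes A :: "real mat"
  assumes "A \<in> carrier_mat n n" "0\<^sub>m n n \<le> A"
  shows "0\<^sub>m n n \<le> A ^\<^sub>m k"
  using assms by (induction k) (auto simp: one_mat_nonneg intro!: mult_mat_nonneg)

lemma pow_mat_add:
  assumes "(A :: 'a :: semiring_1 mat) \<in> carrier_mat n n"
  shows "A ^\<^sub>m (i + j) = A ^\<^sub>m i * A ^\<^sub>m j"
proof -
  interpret semiring "ring_mat TYPE('a) n ()" by (rule semiring_mat)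
  show ?thesis using nat_pow_mult[of A i j] assms
    by (simp add: pow_mat_ring_pow[where b = "()"] ring_mat_simps)
qed

lemma pow_mat_commute:
  assumes "(A :: 'a :: semiring_1 mat) \<in> carrier_mat n n" "B \<in> carrier_mat n n" "A * B = B * A"
  shows "A ^\<^sub>m k * B = B * A ^\<^sub>m k"
proof -
  interpret semiring "ring_mat TYPE('a) n ()" by (rule semiring_mat)
  show ?thesis using group_commutes_pow[of A B k] assms
    by (simp add: pow_mat_ring_pow[where b = "()"] ring_mat_simps)
qed

lemma pow_mat_mult_distrib:
  assumes "(A :: 'a :: semiring_1 mat) \<in> carrier_mat n n" "B \<in> carrier_mat n n" "A * B = B * A"
  shows "(A * B) ^\<^sub>m k = A ^\<^sub>m k * B ^\<^sub>m k"
proof -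
  interpret semiring "ring_mat TYPE('a) n ()" by (rule semiring_mat)
  show ?thesis using pow_mult_distrib[of A B k] assms
    by (simp add: pow_mat_ring_pow[where b = "()", OF mult_carrier_mat[of _ n n _ n]] pow_mat_ring_pow[where b = "()"] ring_mat_simps)
qed

text \<open>Lets \<open>schroeder_R\<close> be evaluated once an explicit two-sided inverse of the
  iterate is known.\<close>

lemma mat_inverse_eqI:
  assumes "(A :: 'a :: field mat) \<in> carrier_mat n n" "B \<in> carrier_mat n n" "A * B = 1\<^sub>m n" "B * A = 1\<^sub>m n"
  shows "mat_inverse A = Some B"
proof (cases "mat_inverse A")
  case None
  moreover have "A \<in> Units (ring_mat TYPE('a) n ())"
    using assms by (auto simp: Units_def ring_mat_simps)
  ultimately show ?thesis using mat_inverse(1)[OF assms(1), where b = "()"] by blast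
next
  case (Some C)
  then have C: "A * C = 1\<^sub>m n" "C \<in> carrier_mat n n"
    using mat_inverse(2)[OF assms(1)] by auto
  have "B = B * (A * C)" using C assms by simp
  also have "\<dots> = B * A * C" by (rule assoc_mult_mat[symmetric]) (use C assms in auto)
  also have "\<dots> = C" using C assms by simp
  finally show ?thesis using Some by simp
qed

text \<open>If an eigenvalue had modulus at least 1, the moduli \<open>w\<close> of an eigenvector
  would satisfy \<open>w <= G w\<close> entrywise, that is \<open>(I - G) w <= 0\<close>.
  Multiplying by the nonnegative left inverse \<open>W\<close> gives \<open>w <= 0\<close>, so the
  eigenvector would vanish.\<close>

lemma spectral_radius_less_one:
  fixes G W :: "real mat"
  assumes n: "n \<ge> 1" and G: "G \<in> carrier_mat n n" "0\<^sub>m n n \<le> G"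
    and W: "W \<in> carrier_mat n n" "0\<^sub>m n n \<le> W" "W * (1\<^sub>m n - G) = 1\<^sub>m n"
  shows "spectral_radius (map_mat complex_of_real G) < 1"
proof (rule ccontr)
  let ?G = "map_mat complex_of_real G"
  assume neg: "\<not> spectral_radius ?G < 1"
  have cG: "?G \<in> carrier_mat n n" using G by simp
  from spectral_radius_mem_max(1)[OF cG] n obtain e where "e \<in> spectrum ?G" "1 \<le> norm e"
    using neg by auto
  then obtain v where v: "v \<in> carrier_vec n" "v \<noteq> 0\<^sub>v n" "?G *\<^sub>v v = e \<cdot>\<^sub>v v"
    using G unfolding spectrum_def eigenvalue_def eigenvector_def by auto
  define w where "w i = norm (v $ i)" for i
  have le: "w r \<le> (\<Sum>c<n. G $$ (r, c) * w c)" if r: "r < n" for r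
  proof -
    have "w r \<le> norm e * w r" using \<open>1 \<le> norm e\<close> by (simp add: w_def mult_le_cancel_right1)
    also have "\<dots> = norm ((e \<cdot>\<^sub>v v) $ r)" using v r by (simp add: w_def norm_mult)
    also have "(e \<cdot>\<^sub>v v) $ r = (\<Sum>c<n. complex_of_real (G $$ (r, c)) * v $ c)"
      unfolding v(3)[symmetric] using r G v(1) by (simp add: scalar_prod_def atLeast0LessThan)
    also have "norm \<dots> \<le> (\<Sum>c<n. G $$ (r, c) * w c)"
      using G r by (intro sum_norm_le) (simp add: w_def norm_mult mat_nonneg_iff)
    finally show ?thesis .
  qed
  have D: "1\<^sub>m n - G \<in> carrier_mat n n" using G(1) by (rule minus_carrier_mat)
  have "w r \<le> 0" if r: "r < n" for r
  proof -
    \<comment> \<open>Expands \<open>w = W (I - G) w\<close> and regroups it, so that the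
      nonpositive vector \<open>(I - G) w\<close> is multiplied by \<open>W\<close>.\<close>
    have "w r = (\<Sum>c<n. if c = r then w c else 0)" using r by simp
    also have "\<dots> = (\<Sum>c<n. (W * (1\<^sub>m n - G)) $$ (r, c) * w c)"
      unfolding W(3) using r by (intro sum.cong) auto
    also have "\<dots> = (\<Sum>c<n. \<Sum>l<n. W $$ (r, l) * ((1\<^sub>m n - G) $$ (l, c) * w c))"
      using r by (intro sum.cong refl) (simp add: mult_mat_nth[OF W(1) D] sum_distrib_right mult.assoc del: index_mult_mat(1))
    also have "\<dots> = (\<Sum>l<n. W $$ (r, l) * (\<Sum>c<n. (1\<^sub>m n - G) $$ (l, c) * w c))"
      by (subst sum.swap) (simp add: sum_distrib_left)
    also have "\<dots> = (\<Sum>l<n. W $$ (r, l) * (w l - (\<Sum>c<n. G $$ (l, c) * w c)))"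
    proof (intro sum.cong refl arg_cong2[where f = "(*)"])
      fix l assume "l \<in> {..<n}"
      then have "(\<Sum>c<n. (1\<^sub>m n - G) $$ (l, c) * w c) = (\<Sum>c<n. (if c = l then w c else 0) - G $$ (l, c) * w c)"
        using G by (intro sum.cong) (auto simp: algebra_simps)
      with \<open>l \<in> {..<n}\<close> show "(\<Sum>c<n. (1\<^sub>m n - G) $$ (l, c) * w c) = w l - (\<Sum>c<n. G $$ (l, c) * w c)"
        by (simp add: sum_subtractf)
    qed
    also have "\<dots> \<le> 0"
      using W r le by (intro sum_nonpos mult_nonneg_nonpos) (auto simp: mat_nonneg_iff)
    finally show ?thesis .
  qed
  then have "v = 0\<^sub>v n" using v(1) by (intro eq_vecI) (auto simp: w_def)
  with v(2) show False by simp
qed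


text \<open>Dividing an eigenvalue of largest modulus by \<open>a\<close> gives an eigenvalue of
  \<open>A\<close> with the same eigenvector.\<close>

lemma spectral_radius_smult_le:
  assumes A: "A \<in> carrier_mat n n" and n: "n \<ge> 1" and a: "a > 0"
  shows "spectral_radius (complex_of_real a \<cdot>\<^sub>m A) \<le> a * spectral_radius A"
proof -
  have "complex_of_real a \<cdot>\<^sub>m A \<in> carrier_mat n n" using A by simp
  from spectral_radius_mem_max(1)[OF this] n obtain e where
    e: "e \<in> spectrum (complex_of_real a \<cdot>\<^sub>m A)" "norm e = spectral_radius (complex_of_real a \<cdot>\<^sub>m A)"
    by auto
  then obtain v where v: "v \<in> carrier_vec n" "v \<noteq> 0\<^sub>v n"
    "(complex_of_real a \<cdot>\<^sub>m A) *\<^sub>v v = e \<cdot>\<^sub>v v"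
    using A unfolding spectrum_def eigenvalue_def eigenvector_def by auto
  have "complex_of_real a \<cdot>\<^sub>v (A *\<^sub>v v) = e \<cdot>\<^sub>v v"
    unfolding v(3)[symmetric] using v(1) A
    by (intro eq_vecI) (auto simp: scalar_prod_def sum_distrib_left mult.assoc)
  then have "A *\<^sub>v v = (e / complex_of_real a) \<cdot>\<^sub>v v"
  proof -
    have "(e / complex_of_real a) \<cdot>\<^sub>v v = (1 / complex_of_real a) \<cdot>\<^sub>v (e \<cdot>\<^sub>v v)"
      by (simp add: smult_smult_assoc)
    also have "\<dots> = (1 / complex_of_real a) \<cdot>\<^sub>v (complex_of_real a \<cdot>\<^sub>v (A *\<^sub>v v))"
      using \<open>complex_of_real a \<cdot>\<^sub>v (A *\<^sub>v v) = e \<cdot>\<^sub>v v\<close> by simp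
    also have "\<dots> = A *\<^sub>v v" using a by (simp add: smult_smult_assoc)
    finally show ?thesis by simp
  qed
  then have "e / complex_of_real a \<in> spectrum A"
    using v A unfolding spectrum_def eigenvalue_def eigenvector_def by auto
  then have "norm (e / complex_of_real a) \<le> spectral_radius A"
    using spectral_radius_mem_max(2)[OF A] n by auto
  then show ?thesis using a e by (simp add: norm_divide field_simps)
qed

text \<open>The criterion applied to every iterate: the M-matrix representation is
  \<open>X = I - G\<close> with \<open>s = 1\<close>, and the nonnegative inverse \<open>W\<close>
  forces the spectral radius of \<open>G\<close> below 1.\<close>

lemma M1_I_inverse_nonneg:
  fixes X W :: "real mat"
  assumes n: "n \<ge> 1" and X: "X \<in> carrier_mat n n" "0\<^sub>m n n \<le> 1\<^sub>m n - X"
    and W: "W \<in> carrier_mat n n" "0\<^sub>m n n \<le> W" "X * W = 1\<^sub>m n" "W * X = 1\<^sub>m n"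
  shows "X \<in> M1 n"
proof -
  define G where "G = 1\<^sub>m n - X"
  have G: "G \<in> carrier_mat n n" "0\<^sub>m n n \<le> G" using X by (auto simp: G_def intro: minus_carrier_mat)
  have XG: "X = 1\<^sub>m n - G" using X by (intro eq_matI) (auto simp: G_def)
  have entries: "X $$ (r, c) \<le> (if r = c then 1 else 0)" if "r < n" "c < n" for r c
    using G(2) that X(1) unfolding G_def by (auto simp: less_eq_mat_def split: if_splits)
  have "spectral_radius (map_mat complex_of_real G) < 1"
    using n G W(1,2,4) unfolding XG by (rule spectral_radius_less_one)
  moreover have "X = 1 \<cdot>\<^sub>m 1\<^sub>m n - G" using X by (intro eq_matI) (auto simp: G_def)
  ultimately have "nonsingular_M_matrix n X" unfolding nonsingular_M_matrix_def using G by blast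
  moreover have "0 < X $$ (i, i)" if i: "i < n" for i
  proof (rule ccontr)
    assume neg: "\<not> 0 < X $$ (i, i)"
    \<comment> \<open>If \<open>X $$ (i, i)\<close> were nonpositive, all of row \<open>i\<close>
      would be, as off-diagonal entries of \<open>X\<close> are nonpositive; its product with a
      nonnegative column of \<open>W\<close> could not be 1.\<close>
    have "1 = (\<Sum>l<n. X $$ (i, l) * W $$ (l, i))"
      using mult_mat_nth[OF X(1) W(1) i i] i unfolding W(3) by simp
    also have "\<dots> \<le> 0"
    proof (intro sum_nonpos mult_nonpos_nonneg)
      fix l assume "l \<in> {..<n}"
      then show "X $$ (i, l) \<le> 0" "0 \<le> W $$ (l, i)"
        using entries[of i l] neg i W by (auto simp: mat_nonneg_iff split: if_splits)
    qed
    finally show False by simp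
  qed
  ultimately show ?thesis unfolding M1_def using entries by force
qed

section \<open>Power series with absolutely summable coefficients\<close>

no_notation vec_index (infixl \<open>$\<close> 100)
unbundle fps_syntax

definition fps_nonneg :: "real fps \<Rightarrow> bool" where
  "fps_nonneg F \<longleftrightarrow> (\<forall>i. 0 \<le> F $ i)"

definition fps_abs_summable :: "real fps \<Rightarrow> bool" where
  "fps_abs_summable F \<longleftrightarrow> summable (\<lambda>i. \<bar>F $ i\<bar>)"

lemma fps_nonneg_mult: "fps_nonneg F \<Longrightarrow> fps_nonneg G \<Longrightarrow> fps_nonneg (F * G)"
  by (auto simp: fps_nonneg_def fps_mult_nth intro!: sum_nonneg)

lemma fps_nonneg_power: "fps_nonneg F \<Longrightarrow> fps_nonneg (F ^ k)"
  by (induction k) (auto simp: fps_nonneg_mult, simp add: fps_nonneg_def)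

lemma fps_abs_summable_mult:
  assumes "fps_abs_summable F" "fps_abs_summable G"
  shows "fps_abs_summable (F * G)"
proof -
  have "summable (\<lambda>k. \<Sum>i\<le>k. \<bar>F $ i\<bar> * \<bar>G $ (k - i)\<bar>)"
    using assms unfolding fps_abs_summable_def by (intro summable_Cauchy_product) auto
  then show ?thesis unfolding fps_abs_summable_def
    by (rule summable_comparison_test')
      (auto simp: fps_mult_nth atLeast0AtMost simp flip: abs_mult intro!: order_trans[OF sum_abs])
qed

lemma fps_abs_summable_finite_support: "(\<And>i. i > N \<Longrightarrow> F $ i = 0) \<Longrightarrow> fps_abs_summable F"
  unfolding fps_abs_summable_def by (rule summable_finite[of "{..N}"]) auto

lemma fps_abs_summable_one: "fps_abs_summable 1"
  by (rule fps_abs_summable_finite_support[of 0]) auto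

lemma fps_abs_summable_X: "fps_abs_summable fps_X"
  by (rule fps_abs_summable_finite_support[of 1]) (auto simp: fps_X_def)

lemma fps_abs_summable_diff:
  assumes "fps_abs_summable F" "fps_abs_summable G"
  shows "fps_abs_summable (F - G)"
  unfolding fps_abs_summable_def
  by (rule summable_comparison_test'[OF summable_add[OF assms[unfolded fps_abs_summable_def]]])
    (use abs_triangle_ineq4 in auto)

lemma fps_abs_summable_power: "fps_abs_summable F \<Longrightarrow> fps_abs_summable (F ^ k)"
  by (induction k) (auto simp: fps_abs_summable_mult fps_abs_summable_one)

text \<open>Evaluation at 1 is multiplicative on absolutely summable series. This is what allows one
  constant to bound all powers of \<open>f(B)\<close>.\<close>

lemma fps_power_sums_one:
  assumes "fps_abs_summable F" "(\<lambda>i. F $ i) sums 1"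
  shows "(\<lambda>i. (F ^ k) $ i) sums 1"
proof (induction k)
  case 0
  then show ?case using sums_finite[of "{0}" "\<lambda>i. (1 :: real fps) $ i"] by simp
next
  case (Suc k)
  have "summable (\<lambda>i. norm (F $ i))" "summable (\<lambda>i. norm ((F ^ k) $ i))"
    using assms(1) fps_abs_summable_power[OF assms(1), of k] by (auto simp: fps_abs_summable_def)
  from Cauchy_product_sums[OF this] show ?case
    using Suc assms(2) by (simp add: fps_mult_nth atLeast0AtMost sums_iff)
qed

text \<open>Apart from the constant term, \<open>F\<close> has nonpositive coefficients, so the
  recurrence for its reciprocal \<open>V\<close> adds only nonnegative terms. Comparing partial sums
  in \<open>V * F = 1\<close> then bounds those of \<open>V\<close> by
  \<open>1 / F(1)\<close>.\<close>

lemma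
  fixes F :: "real fps"
  assumes "fps_nonneg (1 - F)" "F $ 0 = 1"
  shows fps_nonneg_inverse: "fps_nonneg (inverse F)"
    and fps_abs_summable_inverse: "\<lbrakk>fps_abs_summable F; 0 < (\<Sum>i. F $ i)\<rbrakk> \<Longrightarrow> fps_abs_summable (inverse F)"
proof -
  define V where "V = inverse F"
  have rec: "V $ n = - (\<Sum>i=1..n. F $ i * V $ (n - i))" if "n > 0" for n
    using that assms(2) unfolding V_def fps_inverse_def by (cases n) simp_all
  have F_nonpos: "F $ i \<le> 0" if "i > 0" for i
    using assms(1)[unfolded fps_nonneg_def, rule_format, of i] that by simp
  have V0: "V $ 0 = 1" using assms(2) unfolding V_def by simp
  have V_nonneg: "0 \<le> V $ n" for n
  proof (induction n rule: less_induct)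
    case (less n)
    show ?case
    proof (cases "n = 0")
      case False
      then show ?thesis using rec[of n] less F_nonpos
        by (auto simp flip: sum_negf intro!: sum_nonneg mult_nonpos_nonneg)
    qed (simp add: V0)
  qed
  then show "fps_nonneg (inverse F)" unfolding fps_nonneg_def V_def by blast
  assume sF: "fps_abs_summable F" and pos: "0 < (\<Sum>i. F $ i)"
  have sum: "summable (\<lambda>i. F $ i)"
    using sF unfolding fps_abs_summable_def by (rule summable_rabs_cancel)
  have VF: "V * F = 1" using assms(2) unfolding V_def by (simp add: inverse_mult_eq_1)
  have bound: "(\<Sum>n\<le>N. V $ n) \<le> 1 / (\<Sum>i. F $ i)" for N
  proof -
    \<comment> \<open>The coefficients of \<open>V * F\<close> up to \<open>N\<close> are regrouped
      by the index of \<open>V\<close>: each \<open>V $ i\<close> is weighted by a partial sum of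
      \<open>F\<close>, which is at least the full sum because the omitted coefficients are
      nonpositive.\<close>
    have "1 = (\<Sum>n\<le>N. (V * F) $ n)" unfolding VF by simp
    also have "\<dots> = (\<Sum>n\<le>N. \<Sum>i\<le>n. V $ i * F $ (n-i))"
      by (simp add: fps_mult_nth atLeast0AtMost)
    also have "\<dots> = (\<Sum>(n,i)\<in>Sigma {..N} (\<lambda>n. {..n}). F $ (n-i) * V $ i)"
      by (simp add: sum.Sigma mult.commute)
    also have "\<dots> = (\<Sum>(i,j)\<in>Sigma {..N} (\<lambda>i. {..N-i}). F $ j * V $ i)"
      by (rule sum.reindex_bij_witness[where i="\<lambda>(i,j). (i+j,i)" and j="\<lambda>(n,i). (i,n-i)"]) auto
    also have "\<dots> = (\<Sum>i\<le>N. (\<Sum>j\<le>N-i. F $ j) * V $ i)"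
      by (simp add: sum.Sigma sum_distrib_right)
    also have "\<dots> \<ge> (\<Sum>i\<le>N. (\<Sum>j. F $ j) * V $ i)"
    proof (intro sum_mono mult_right_mono V_nonneg)
      fix i
      have "suminf (\<lambda>j. F $ j) = (\<Sum>j. F $ (j + Suc (N-i))) + (\<Sum>j<Suc (N-i). F $ j)"
        by (rule suminf_split_initial_segment[OF sum])
      moreover have "(\<Sum>j. F $ (j + Suc (N-i))) \<le> (\<Sum>j. 0)"
        using F_nonpos summable_ignore_initial_segment[OF sum, of "Suc (N-i)"]
        by (intro suminf_le) (auto intro: summable_comparison_test)
      ultimately show "suminf (\<lambda>j. F $ j) \<le> (\<Sum>j\<le>N-i. F $ j)"
        by (simp add: lessThan_Suc_atMost)
    qed
    finally show ?thesis using pos by (simp add: field_simps sum_distrib_left)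
  qed
  show "fps_abs_summable (inverse F)"
    unfolding fps_abs_summable_def V_def[symmetric]
    using V_nonneg bound
    by (intro bounded_imp_summable[where B="1 / (\<Sum>i. F $ i)"]) auto
qed

section \<open>Coefficients of the residual map\<close>

locale schroeder =
  fixes p m :: nat
  assumes p: "p \<ge> 2"
begin

definition "T = Abs_fps (\<lambda>i. if i \<le> m then schroeder_coeff p i else 0)"
definition "V = inverse T"

text \<open>The residual of the scalar iteration evolves by f: if R(x) = t, then
  R(x T(t)) = 1 - (1 - t) T(t)^(-p) = f(t).\<close>
definition "f = 1 - (1 - fps_X) * V ^ p"
text \<open>This is \<open>T * f\<close> (see \<open>h_eq\<close>), written so that
  \<open>deriv_one_minus_V_power\<close> applies directly.\<close>

definition "h = T - (1 - fps_X) * V ^ (p - 1)"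

abbreviation "b \<equiv> schroeder_coeff p"
text \<open>By \<open>coeff_Suc\<close> this equals \<open>- p (m + 1) b (m + 1)\<close>: what the
  first omitted term of the root series would have cancelled in the differential equation.\<close>

definition "d = (1 - real p * real m) * b m"

lemma coeff_0: "b 0 = 1" by (simp add: schroeder_coeff_def)

text \<open>The Pochhammer recurrence cleared of denominators; it is coefficient \<open>i\<close> of
  \<open>S + p (1 - t) S' = 0\<close> for \<open>S = (1 - t)^(1/p)\<close>.\<close>

lemma coeff_Suc: "real p * real (Suc i) * b (Suc i) = (real p * real i - 1) * b i"
proof -
  have "real (Suc i) * b (Suc i) = (real i - 1 / real p) * b i"
    unfolding schroeder_coeff_def pochhammer_Suc fact_Suc of_nat_mult
    by (simp add: divide_simps del: of_nat_Suc)
  then have "real p * (real (Suc i) * b (Suc i)) = (real p * (real i - 1 / real p)) * b i"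
    by simp
  also have "real p * (real i - 1 / real p) = real p * real i - 1"
    using p by (simp add: field_simps)
  finally show ?thesis by (simp only: mult.assoc)
qed

text \<open>The coefficient of index 1 is \<open>-1/p\<close>, and the factor \<open>p i - 1\<close>
  in \<open>coeff_Suc\<close> is nonnegative from \<open>i = 1\<close> on, so the sign
  persists.\<close>

lemma coeff_nonpos: "b (Suc i) \<le> 0"
proof (induction i)
  case 0
  then show ?case using p by (simp add: schroeder_coeff_def)
next
  case (Suc i)
  have "1 \<le> real p * real (Suc i)" using p mult_mono[of 1 "real p" 1 "real (Suc i)"] by simp
  then have "real p * real (Suc (Suc i)) * b (Suc (Suc i)) \<le> 0"
    unfolding coeff_Suc using Suc by (intro mult_nonneg_nonpos) auto
  then show ?case using p by (simp add: mult_le_0_iff)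
qed

text \<open>Partial sums are the coefficients of \<open>(1 - t)^(1/p) / (1 - t)\<close>, a power of
  \<open>1 - t\<close> with exponent \<open>-(1 - 1/p)\<close>; hence the closed form. The result
  gives \<open>T(1) > 0\<close>, on which the summability of \<open>1/T\<close> rests.\<close>

lemma sum_coeff_pos: "0 < (\<Sum>i\<le>k. b i)"
proof -
  have "(\<Sum>i\<le>k. b i) = pochhammer (1 - 1 / real p) k / fact k"
  proof (induction k)
    case (Suc k)
    define a where "a = 1 / real p"
    have "b (Suc k) = - a * pochhammer (1 - a) k / fact (Suc k)"
      by (simp add: schroeder_coeff_def pochhammer_rec a_def)
    with Suc show ?case unfolding a_def[symmetric]
      by (simp add: pochhammer_Suc divide_simps) (simp add: algebra_simps)
  qed (simp add: coeff_0)
  also have "\<dots> > 0" using p by (intro divide_pos_pos pochhammer_pos) auto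
  finally show ?thesis .
qed

section \<open>The truncated root series and its reciprocal\<close>

lemma T_0: "T $ 0 = 1" by (simp add: T_def coeff_0)

lemma T_V: "T * V = 1" unfolding V_def using T_0 by (simp add: inverse_mult_eq_1')

lemma one_minus_T_nonneg: "fps_nonneg (1 - T)"
  unfolding fps_nonneg_def
proof
  fix i show "0 \<le> (1 - T) $ i" using coeff_nonpos[of "i - 1"] T_0 by (cases i) (auto simp: T_def)
qed

lemma T_summable: "fps_abs_summable T"
  by (rule fps_abs_summable_finite_support[of m]) (simp add: T_def)

lemma V_nonneg: "fps_nonneg V"
  unfolding V_def using one_minus_T_nonneg T_0 by (rule fps_nonneg_inverse)

lemma V_summable: "fps_abs_summable V"
proof -
  have "(\<Sum>i. T $ i) = (\<Sum>i\<le>m. b i)"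
    by (subst suminf_finite[of "{..m}"]) (auto simp: T_def)
  then show ?thesis unfolding V_def
    using one_minus_T_nonneg T_0 T_summable sum_coeff_pos by (intro fps_abs_summable_inverse) auto
qed

text \<open>The full series S of (1 - t)^(1/p) satisfies S + p (1 - t) S' = 0; truncating it leaves a
  single monomial as defect.\<close>
lemma T_ode: "T + of_nat p * (1 - fps_X) * fps_deriv T = fps_const d * fps_X ^ m"
proof (rule fps_ext)
  fix i
  have "(T + of_nat p * (1 - fps_X) * fps_deriv T) $ i =
        T $ i + real p * (real (Suc i) * T $ Suc i - real i * T $ i)"
    by (cases i) (simp_all add: algebra_simps fps_of_nat[symmetric])
  also have "\<dots> = (if i = m then (1 - real p * real m) * b m else 0)"
    using coeff_Suc[of i] by (auto simp: T_def algebra_simps)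
  finally show "(T + of_nat p * (1 - fps_X) * fps_deriv T) $ i =
     (fps_const d * fps_X ^ m) $ i" by (simp add: fps_X_power_iff d_def)
qed

lemma V_power_nth_nonneg: "0 \<le> (V ^ k) $ i"
  using fps_nonneg_power[OF V_nonneg] unfolding fps_nonneg_def by blast

section \<open>Derivatives, vanishing order and signs of \<open>f\<close> and
  \<open>h\<close>\<close>

lemma V_deriv: "fps_deriv V = - fps_deriv T * V\<^sup>2"
  unfolding V_def using T_0 by (intro fps_inverse_deriv) simp

text \<open>Stated for general \<open>q\<close> because \<open>f\<close> uses \<open>q = p\<close>
  and \<open>h\<close> uses \<open>q = p - 1\<close>.\<close>

lemma deriv_one_minus_V_power:
  "fps_deriv ((1 - fps_X) * V ^ q) = - (V ^ q) - of_nat q * (1 - fps_X) * fps_deriv T * V ^ Suc q"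
proof (cases q)
  case (Suc n)
  have "fps_deriv (V ^ q) = - of_nat q * fps_deriv T * V ^ Suc q"
    unfolding fps_deriv_power' V_deriv Suc by (simp add: algebra_simps power2_eq_square)
  then show ?thesis unfolding fps_deriv_mult by (simp add: algebra_simps)
qed simp

text \<open>Writing \<open>V ^ p\<close> as \<open>T * V * V ^ p\<close> allows
  \<open>V ^ Suc p\<close> to be factored out; what remains is the left side of
  \<open>T_ode\<close>.\<close>

lemma f_deriv: "fps_deriv f = fps_const d * (fps_X ^ m * V ^ Suc p)"
proof -
  have "fps_deriv f = (T * V) * V ^ p + of_nat p * (1 - fps_X) * fps_deriv T * V ^ Suc p"
    unfolding f_def fps_deriv_sub deriv_one_minus_V_power T_V by simp
  also have "\<dots> = (T + of_nat p * (1 - fps_X) * fps_deriv T) * V ^ Suc p"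
    by (simp add: algebra_simps)
  finally show ?thesis unfolding T_ode by (simp add: mult.assoc)
qed

lemma h_eq: "h = T * f"
proof -
  have "T * V ^ p = T * V * V ^ (p - 1)" using p by (cases p) auto
  then show ?thesis unfolding h_def f_def T_V by (simp add: algebra_simps)
qed

lemma f_eq: "f = V * h"
  unfolding h_eq using T_V by (simp add: mult.assoc[symmetric] mult.commute[of V])

text \<open>The factor \<open>p\<close> makes \<open>T_ode\<close> applicable to
  \<open>p (1 - t) T'\<close>. The resulting term \<open>- (p - 1) T V^p\<close> equals
  \<open>- (p - 1) V^(p-1)\<close> and leaves just one of the \<open>p\<close> copies of
  \<open>V^(p-1)\<close>.\<close>

lemma h_deriv: "of_nat p * fps_deriv h =
  of_nat p * fps_deriv T + V ^ (p - 1) + of_nat (p - 1) * fps_const d * (fps_X ^ m * V ^ p)"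
proof -
  have p': "Suc (p - 1) = p" using p by simp
  have "of_nat p * fps_deriv h = of_nat p * fps_deriv T + of_nat p * V ^ (p - 1) +
    of_nat (p - 1) * (of_nat p * (1 - fps_X) * fps_deriv T) * V ^ p"
    unfolding h_def fps_deriv_sub deriv_one_minus_V_power p' by (simp add: algebra_simps)
  also have "of_nat p * (1 - fps_X) * fps_deriv T = fps_const d * fps_X ^ m - T"
    using T_ode by (simp add: algebra_simps)
  also have "of_nat (p - 1) * (fps_const d * fps_X ^ m - T) * V ^ p =
    of_nat (p - 1) * fps_const d * (fps_X ^ m * V ^ p) - of_nat (p - 1) * (T * V ^ p)"
    by (simp add: algebra_simps)
  also have "T * V ^ p = V ^ (p - 1)"
    using T_V by (subst p'[symmetric]) (simp add: mult.assoc[symmetric])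
  also have "of_nat p * V ^ (p - 1) = of_nat (p - 1) * V ^ (p - 1) + V ^ (p - 1)"
    by (subst p'[symmetric]) (simp add: algebra_simps)
  finally show ?thesis by (simp add: algebra_simps)
qed

lemma f_nth_0: "f $ 0 = 0"
proof -
  have "V $ 0 = 1" unfolding V_def using T_0 by simp
  then show ?thesis by (simp add: f_def fps_power_zeroth)
qed

text \<open>The constant term is zero and the derivative in \<open>f_deriv\<close> carries the
  factor \<open>fps_X ^ m\<close>.\<close>

lemma f_order: "i \<le> m \<Longrightarrow> f $ i = 0"
proof (cases i)
  case (Suc j)
  assume "i \<le> m"
  have "fps_deriv f $ j = 0"
    unfolding f_deriv using \<open>i \<le> m\<close> Suc by (simp add: fps_X_power_mult_nth)
  then show ?thesis using Suc by simp
qed (simp add: f_nth_0)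

lemma h_order: "i \<le> m \<Longrightarrow> h $ i = 0"
  unfolding h_eq by (auto simp: fps_mult_nth f_order intro!: sum.neutral)

text \<open>Below order m the coefficients vanish because T agrees with the full root series; from
  order m on, the polynomial T no longer contributes to the derivative.\<close>
lemma h_nonneg: "fps_nonneg h"
  unfolding fps_nonneg_def
proof
  fix i
  show "0 \<le> h $ i"
  proof (cases "i \<le> m")
    case False
    then obtain j where j: "i = Suc j" "j \<ge> m" by (cases i) auto
    have d: "0 \<le> d"
    proof (cases m)
      case (Suc k)
      then have "1 \<le> real p * real m" using p mult_mono[of 1 "real p" 1 "real m"] by simp
      then show ?thesis using coeff_nonpos[of k] Suc
        unfolding d_def by (intro mult_nonpos_nonpos) auto
    next
      case 0
      then show ?thesis unfolding d_def by (simp add: coeff_0)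
    qed
    have "(of_nat p * fps_deriv h) $ j = (V ^ (p - 1)) $ j + real (p - 1) * d * (fps_X ^ m * V ^ p) $ j"
      unfolding h_deriv using j by (simp add: T_def mult.assoc fps_of_nat[symmetric])
    also have "\<dots> \<ge> 0"
      using d by (auto simp: fps_X_power_mult_nth V_power_nth_nonneg)
    finally have "0 \<le> real p * (real (Suc j) * h $ Suc j)" by (simp add: fps_of_nat[symmetric])
    then show ?thesis using p j by (simp add: zero_le_mult_iff)
  qed (simp add: h_order)
qed

lemma f_nonneg: "fps_nonneg f"
  unfolding f_eq by (intro fps_nonneg_mult V_nonneg h_nonneg)

section \<open>Summability of \<open>f\<close> and \<open>h\<close>, and the value
  \<open>f(1)\<close>\<close>

lemma one_minus_X_summable: "fps_abs_summable (1 - fps_X)"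
  by (intro fps_abs_summable_diff fps_abs_summable_one fps_abs_summable_X)

lemma f_summable: "fps_abs_summable f"
  unfolding f_def
  by (intro fps_abs_summable_diff fps_abs_summable_mult fps_abs_summable_power
      fps_abs_summable_one one_minus_X_summable V_summable)

lemma h_summable: "fps_abs_summable h"
  unfolding h_eq by (intro fps_abs_summable_mult T_summable f_summable)

text \<open>The coefficients of \<open>1 - fps_X\<close> sum to 0, so the product subtracted from 1
  in \<open>f\<close> contributes nothing. With \<open>f_nonneg\<close> this makes
  \<open>f(B)\<close> an infinite convex combination of powers of \<open>B\<close>.\<close>

lemma f_sums: "(\<lambda>i. f $ i) sums 1"
proof -
  define g where "g = (1 - fps_X) * V ^ p"
  have "summable (\<lambda>i. norm ((1 - fps_X :: real fps) $ i))" "summable (\<lambda>i. norm ((V ^ p) $ i))"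
    using one_minus_X_summable fps_abs_summable_power[OF V_summable]
    by (auto simp: fps_abs_summable_def)
  from Cauchy_product_sums[OF this]
  have "(\<lambda>i. g $ i) sums ((\<Sum>i. (1 - fps_X :: real fps) $ i) * (\<Sum>i. (V ^ p) $ i))"
    by (simp add: fps_mult_nth atLeast0AtMost g_def)
  moreover have "(\<Sum>i. (1 - fps_X :: real fps) $ i) = 0"
    by (subst suminf_finite[of "{..1}"]) (auto simp: fps_X_def)
  ultimately have "(\<lambda>i. g $ i) sums 0" by simp
  moreover have "(\<lambda>i. (1 :: real fps) $ i) sums 1"
    using sums_finite[of "{0}" "\<lambda>i. (1 :: real fps) $ i"] by simp
  ultimately show ?thesis unfolding f_def g_def[symmetric] using sums_diff by fastforce
qed

end

section \<open>Evaluating power series at power-bounded matrices\<close>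

definition power_bounded :: "nat \<Rightarrow> real mat \<Rightarrow> bool" where
  "power_bounded n B \<longleftrightarrow>
     B \<in> carrier_mat n n \<and> (\<exists>K. \<forall>i. \<forall>r<n. \<forall>c<n. \<bar>(B ^\<^sub>m i) $$ (r, c)\<bar> \<le> K)"

text \<open>An entrywise \<open>suminf\<close>, meaningful where the series converge;
  \<open>fps_mat_summable\<close> ensures this for power-bounded arguments.\<close>

definition fps_mat :: "nat \<Rightarrow> real fps \<Rightarrow> real mat \<Rightarrow> real mat" where
  "fps_mat n F B = mat n n (\<lambda>(r, c). \<Sum>i. F $ i * (B ^\<^sub>m i) $$ (r, c))"

lemma fps_mat_carrier [simp]: "fps_mat n F B \<in> carrier_mat n n"
  by (simp add: fps_mat_def)

lemma fps_mat_dim [simp]: "dim_row (fps_mat n F B) = n" "dim_col (fps_mat n F B) = n"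
  by (simp_all add: fps_mat_def)

lemma fps_mat_nth: "r < n \<Longrightarrow> c < n \<Longrightarrow> fps_mat n F B $$ (r, c) = (\<Sum>i. F $ i * (B ^\<^sub>m i) $$ (r, c))"
  by (simp add: fps_mat_def)

lemma power_bounded_carrier: "power_bounded n B \<Longrightarrow> B \<in> carrier_mat n n"
  by (simp add: power_bounded_def)

lemma fps_mat_abs_summable:
  assumes "power_bounded n B" "fps_abs_summable F" "r < n" "c < n"
  shows "summable (\<lambda>i. \<bar>F $ i * (B ^\<^sub>m i) $$ (r, c)\<bar>)"
proof -
  obtain K where K: "\<bar>(B ^\<^sub>m i) $$ (r, c)\<bar> \<le> K" for i
    using assms unfolding power_bounded_def by blast
  have "summable (\<lambda>i. \<bar>F $ i\<bar> * K)"
    using assms(2) unfolding fps_abs_summable_def by (rule summable_mult2)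
  then show ?thesis
    by (rule summable_comparison_test') (auto simp: abs_mult K intro!: mult_left_mono)
qed

lemma fps_mat_summable:
  assumes "power_bounded n B" "fps_abs_summable F" "r < n" "c < n"
  shows "summable (\<lambda>i. F $ i * (B ^\<^sub>m i) $$ (r, c))"
  using fps_mat_abs_summable[OF assms] by (rule summable_rabs_cancel)

lemma fps_mat_nth_finite:
  assumes "\<And>i. i > N \<Longrightarrow> F $ i = 0" "r < n" "c < n"
  shows "fps_mat n F B $$ (r, c) = (\<Sum>i\<le>N. F $ i * (B ^\<^sub>m i) $$ (r, c))"
  unfolding fps_mat_nth[OF assms(2,3)] by (rule suminf_finite) (use assms(1) in auto)

lemma fps_mat_one: "B \<in> carrier_mat n n \<Longrightarrow> fps_mat n 1 B = 1\<^sub>m n"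
  by (intro eq_matI) (auto simp: fps_mat_nth_finite[where N = 0])

lemma fps_mat_X: "B \<in> carrier_mat n n \<Longrightarrow> fps_mat n fps_X B = B"
  by (intro eq_matI) (auto simp: fps_mat_nth_finite[where N = 1] fps_X_def)

lemma fps_mat_diff:
  assumes "power_bounded n B" "fps_abs_summable F" "fps_abs_summable G"
  shows "fps_mat n (F - G) B = fps_mat n F B - fps_mat n G B"
  by (intro eq_matI)
    (auto simp: fps_mat_nth left_diff_distrib intro!: suminf_diff[symmetric] fps_mat_summable assms)

text \<open>Entrywise Cauchy products, one for each inner index \<open>l\<close>, are summed over
  \<open>l\<close>; the identity \<open>B^i B^(k-i) = B^k\<close> then collects the coefficient
  \<open>(F * G) $ k\<close>.\<close>

lemma fps_mat_mult:
  assumes B: "power_bounded n B" and FG: "fps_abs_summable F" "fps_abs_summable G"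
  shows "fps_mat n (F * G) B = fps_mat n F B * fps_mat n G B"
proof (rule eq_matI)
  note cB = power_bounded_carrier[OF B]
  fix r c assume "r < dim_row (fps_mat n F B * fps_mat n G B)" "c < dim_col (fps_mat n F B * fps_mat n G B)"
  then have rc: "r < n" "c < n" by auto
  have "(\<lambda>k. \<Sum>i\<le>k. (F $ i * (B ^\<^sub>m i) $$ (r, l)) * (G $ (k - i) * (B ^\<^sub>m (k - i)) $$ (l, c)))
     sums ((\<Sum>i. F $ i * (B ^\<^sub>m i) $$ (r, l)) * (\<Sum>i. G $ i * (B ^\<^sub>m i) $$ (l, c)))"
    if "l < n" for l
    using fps_mat_abs_summable[OF B] FG rc that by (intro Cauchy_product_sums) auto
  then have "(\<lambda>k. \<Sum>l<n. \<Sum>i\<le>k. (F $ i * (B ^\<^sub>m i) $$ (r, l)) * (G $ (k - i) * (B ^\<^sub>m (k - i)) $$ (l, c)))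
     sums (\<Sum>l<n. (\<Sum>i. F $ i * (B ^\<^sub>m i) $$ (r, l)) * (\<Sum>i. G $ i * (B ^\<^sub>m i) $$ (l, c)))"
    by (intro sums_sum) auto
  also have "(\<Sum>l<n. (\<Sum>i. F $ i * (B ^\<^sub>m i) $$ (r, l)) * (\<Sum>i. G $ i * (B ^\<^sub>m i) $$ (l, c)))
     = (fps_mat n F B * fps_mat n G B) $$ (r, c)"
    using rc by (simp add: mult_mat_nth[of _ n] fps_mat_nth del: index_mult_mat(1))
  also have "(\<lambda>k. \<Sum>l<n. \<Sum>i\<le>k. (F $ i * (B ^\<^sub>m i) $$ (r, l)) * (G $ (k - i) * (B ^\<^sub>m (k - i)) $$ (l, c)))
     = (\<lambda>k. (F * G) $ k * (B ^\<^sub>m k) $$ (r, c))"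
  proof
    fix k
    have "(\<Sum>l<n. \<Sum>i\<le>k. (F $ i * (B ^\<^sub>m i) $$ (r, l)) * (G $ (k - i) * (B ^\<^sub>m (k - i)) $$ (l, c)))
      = (\<Sum>i\<le>k. F $ i * G $ (k - i) * (\<Sum>l<n. (B ^\<^sub>m i) $$ (r, l) * (B ^\<^sub>m (k - i)) $$ (l, c)))"
      by (subst sum.swap) (simp add: sum_distrib_left mult_ac)
    also have "\<dots> = (\<Sum>i\<le>k. F $ i * G $ (k - i) * (B ^\<^sub>m k) $$ (r, c))"
    proof (intro sum.cong refl arg_cong2[where f = "(*)"])
      fix i assume "i \<in> {..k}"
      then have "B ^\<^sub>m k = B ^\<^sub>m i * B ^\<^sub>m (k - i)"
        using pow_mat_add[OF cB, of i "k - i"] by simp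
      then show "(\<Sum>l<n. (B ^\<^sub>m i) $$ (r, l) * (B ^\<^sub>m (k - i)) $$ (l, c)) = (B ^\<^sub>m k) $$ (r, c)"
        using mult_mat_nth[of "B ^\<^sub>m i" n "B ^\<^sub>m (k - i)" r c] cB rc by simp
    qed
    also have "\<dots> = (F * G) $ k * (B ^\<^sub>m k) $$ (r, c)"
      by (simp add: fps_mult_nth atLeast0AtMost sum_distrib_right)
    finally show "(\<Sum>l<n. \<Sum>i\<le>k. (F $ i * (B ^\<^sub>m i) $$ (r, l)) * (G $ (k - i) * (B ^\<^sub>m (k - i)) $$ (l, c)))
      = (F * G) $ k * (B ^\<^sub>m k) $$ (r, c)" .
  qed
  finally show "fps_mat n (F * G) B $$ (r, c) = (fps_mat n F B * fps_mat n G B) $$ (r, c)"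
    using rc by (simp add: fps_mat_nth sums_iff)
qed auto

lemma fps_mat_power:
  assumes "power_bounded n B" "fps_abs_summable F"
  shows "fps_mat n (F ^ k) B = fps_mat n F B ^\<^sub>m k"
proof (induction k)
  case 0
  then show ?case using assms by (simp add: fps_mat_one power_bounded_carrier)
next
  case (Suc k)
  have "fps_mat n (F ^ Suc k) B = fps_mat n (F ^ k * F) B" by (simp add: mult.commute)
  then show ?case using Suc assms by (simp add: fps_mat_mult fps_abs_summable_power)
qed

text \<open>Each entry of a product with \<open>Z\<close> is a finite linear combination of entries
  of the series, so \<open>Z\<close> may be moved inside the infinite sum.\<close>

lemma mult_fps_mat_nth:
  assumes B: "power_bounded n B" and F: "fps_abs_summable F" and Z: "Z \<in> carrier_mat n n"
    and rc: "r < n" "c < n"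
  shows "(\<lambda>i. F $ i * (Z * B ^\<^sub>m i) $$ (r, c)) sums (Z * fps_mat n F B) $$ (r, c)"
    and "(\<lambda>i. F $ i * (B ^\<^sub>m i * Z) $$ (r, c)) sums (fps_mat n F B * Z) $$ (r, c)"
proof -
  note cB = power_bounded_carrier[OF B]
  have "(\<lambda>i. \<Sum>l<n. Z $$ (r, l) * (F $ i * (B ^\<^sub>m i) $$ (l, c))) sums
     (\<Sum>l<n. Z $$ (r, l) * fps_mat n F B $$ (l, c))"
    using rc by (intro sums_sum sums_mult) (auto simp: fps_mat_nth intro!: summable_sums fps_mat_summable B F)
  then show "(\<lambda>i. F $ i * (Z * B ^\<^sub>m i) $$ (r, c)) sums (Z * fps_mat n F B) $$ (r, c)"
    using cB Z rc by (simp add: mult_mat_nth[of _ n] sum_distrib_left mult_ac del: index_mult_mat(1))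
  have "(\<lambda>i. \<Sum>l<n. (F $ i * (B ^\<^sub>m i) $$ (r, l)) * Z $$ (l, c)) sums
     (\<Sum>l<n. fps_mat n F B $$ (r, l) * Z $$ (l, c))"
    using rc by (intro sums_sum sums_mult2) (auto simp: fps_mat_nth intro!: summable_sums fps_mat_summable B F)
  then show "(\<lambda>i. F $ i * (B ^\<^sub>m i * Z) $$ (r, c)) sums (fps_mat n F B * Z) $$ (r, c)"
    using cB Z rc by (simp add: mult_mat_nth[of _ n] sum_distrib_left mult_ac del: index_mult_mat(1))
qed

lemma fps_mat_commute:
  assumes B: "power_bounded n B" and F: "fps_abs_summable F" and Z: "Z \<in> carrier_mat n n"
    and com: "B * Z = Z * B"
  shows "fps_mat n F B * Z = Z * fps_mat n F B"
proof (rule eq_matI)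
  note cB = power_bounded_carrier[OF B]
  fix r c assume "r < dim_row (Z * fps_mat n F B)" "c < dim_col (Z * fps_mat n F B)"
  then have rc: "r < n" "c < n" using Z by auto
  show "(fps_mat n F B * Z) $$ (r, c) = (Z * fps_mat n F B) $$ (r, c)"
    using mult_fps_mat_nth[OF B F Z rc] unfolding pow_mat_commute[OF cB Z com] by (rule sums_unique2[rotated])
qed (use Z in auto)

text \<open>\<open>Z\<close> may have negative entries. Since \<open>F\<close> has no constant term,
  only the matrices \<open>Z B^(j+1) = (Z B) B^j\<close> occur, and these are nonnegative.\<close>

lemma mult_fps_mat_nonneg:
  assumes B: "power_bounded n B" "0\<^sub>m n n \<le> B" and F: "fps_abs_summable F" "fps_nonneg F" "F $ 0 = 0"
    and Z: "Z \<in> carrier_mat n n" "0\<^sub>m n n \<le> Z * B"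
  shows "0\<^sub>m n n \<le> Z * fps_mat n F B"
proof -
  note cB = power_bounded_carrier[OF B(1)]
  have "0 \<le> (Z * fps_mat n F B) $$ (r, c)" if rc: "r < n" "c < n" for r c
  proof (rule sums_le[OF _ sums_zero mult_fps_mat_nth(1)[OF B(1) F(1) Z(1) rc]])
    fix i
    show "0 \<le> F $ i * (Z * B ^\<^sub>m i) $$ (r, c)"
    proof (cases i)
      case (Suc j)
      have "Z * B ^\<^sub>m i = Z * B * B ^\<^sub>m j"
        using pow_mat_add[OF cB, of 1 j] cB Z assoc_mult_mat[of Z n n B n "B ^\<^sub>m j" n] Suc by simp
      moreover have "0\<^sub>m n n \<le> Z * B * B ^\<^sub>m j"
        using cB Z(1) by (intro mult_mat_nonneg[OF _ _ Z(2)] pow_mat_nonneg B) auto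
      ultimately have "0 \<le> (Z * B ^\<^sub>m i) $$ (r, c)" using mat_nonnegD rc by metis
      then show ?thesis using F(2) by (simp add: fps_nonneg_def)
    qed (simp add: F)
  qed
  then show ?thesis using Z by (subst mat_nonneg_iff) auto
qed

lemma fps_mat_nonneg:
  assumes B: "power_bounded n B" "0\<^sub>m n n \<le> B" and F: "fps_abs_summable F" "fps_nonneg F"
  shows "0\<^sub>m n n \<le> fps_mat n F B"
proof -
  have "0 \<le> fps_mat n F B $$ (r, c)" if "r < n" "c < n" for r c
  proof -
    have "0 \<le> (B ^\<^sub>m i) $$ (r, c)" for i
      using pow_mat_nonneg[OF power_bounded_carrier[OF B(1)] B(2)] that by (rule mat_nonnegD)
    then show ?thesis using that F(2) fps_mat_summable[OF B(1) F(1) that]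
      by (auto simp: fps_mat_nth fps_nonneg_def intro!: suminf_nonneg)
  qed
  then show ?thesis by (subst mat_nonneg_iff) auto
qed

text \<open>\<open>F(B)^k\<close> is the value of \<open>F ^ k\<close> at \<open>B\<close>, and
  \<open>F ^ k\<close> again has nonnegative coefficients with sum 1. Hence a bound for the powers
  of \<open>B\<close> also bounds those of \<open>F(B)\<close>.\<close>

lemma power_bounded_fps_mat:
  assumes B: "power_bounded n B"
    and F: "fps_nonneg F" "fps_abs_summable F" "(\<lambda>i. F $ i) sums 1"
  shows "power_bounded n (fps_mat n F B)"
proof -
  obtain K where K: "\<bar>(B ^\<^sub>m i) $$ (r, c)\<bar> \<le> K" if "r < n" "c < n" for i r c
    using B unfolding power_bounded_def by blast
  have "\<bar>(fps_mat n F B ^\<^sub>m k) $$ (r, c)\<bar> \<le> K" if rc: "r < n" "c < n" for k r c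
  proof -
    note Fk = fps_abs_summable_power[OF F(2), of k]
    have "\<bar>(fps_mat n F B ^\<^sub>m k) $$ (r, c)\<bar> = \<bar>\<Sum>i. (F ^ k) $ i * (B ^\<^sub>m i) $$ (r, c)\<bar>"
      unfolding fps_mat_power[OF B F(2), symmetric] using rc by (simp add: fps_mat_nth)
    also have "\<dots> \<le> (\<Sum>i. \<bar>(F ^ k) $ i * (B ^\<^sub>m i) $$ (r, c)\<bar>)"
      by (rule summable_rabs[OF fps_mat_abs_summable[OF B Fk rc]])
    also have "\<dots> \<le> (\<Sum>i. (F ^ k) $ i * K)"
    proof (rule suminf_le[OF _ fps_mat_abs_summable[OF B Fk rc]])
      show "summable (\<lambda>i. (F ^ k) $ i * K)"
        using fps_power_sums_one[OF F(2,3), of k] by (intro summable_mult2) (simp add: sums_iff)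
      show "\<bar>(F ^ k) $ i * (B ^\<^sub>m i) $$ (r, c)\<bar> \<le> (F ^ k) $ i * K" for i
        using fps_nonneg_power[OF F(1), of k] K[OF rc] by (auto simp: abs_mult fps_nonneg_def intro!: mult_left_mono)
    qed
    also have "\<dots> = K"
      using fps_power_sums_one[OF F(2,3), of k] by (subst suminf_mult2[symmetric]) (auto simp: sums_iff)
    finally show ?thesis .
  qed
  then show ?thesis unfolding power_bounded_def by auto
qed

section \<open>From M-matrices to power-bounded residuals\<close>

lemma power_bounded_of_inverse_nonneg:
  assumes B: "B \<in> carrier_mat n n" "0\<^sub>m n n \<le> B"
    and Y: "Y \<in> carrier_mat n n" "0\<^sub>m n n \<le> Y" "Y * (1\<^sub>m n - B) = 1\<^sub>m n"
  shows "power_bounded n B"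
proof -
  \<comment> \<open>Reading \<open>Y (I - B) = I\<close> as \<open>Y = I + Y B\<close> gives both
    \<open>I <= Y\<close> and \<open>Y B <= Y\<close>; by induction every power of \<open>B\<close>
    stays below \<open>Y\<close>.\<close>
  have Y_eq: "Y $$ (r, c) = 1\<^sub>m n $$ (r, c) + (Y * B) $$ (r, c)" if "r < n" "c < n" for r c
  proof -
    have "Y * (1\<^sub>m n - B) = Y * 1\<^sub>m n - Y * B"
      using B Y by (intro mult_minus_distrib_mat) auto
    then have "1\<^sub>m n $$ (r, c) = (Y - Y * B) $$ (r, c)" using Y by simp
    also have "\<dots> = Y $$ (r, c) - (Y * B) $$ (r, c)"
      using that B Y by (simp del: index_mult_mat(1))
    finally show ?thesis by simp
  qed
  have bound: "(B ^\<^sub>m i) $$ (r, c) \<le> Y $$ (r, c)" if "r < n" "c < n" for i r c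
    using that
  proof (induction i arbitrary: r c)
    case 0
    have "0 \<le> (Y * B) $$ (r, c)"
      using mult_mat_nonneg[OF Y(1) B(1) Y(2) B(2)] 0 by (rule mat_nonnegD)
    then show ?case using Y_eq[of r c] 0 B by simp
  next
    case (Suc i)
    have "(B ^\<^sub>m Suc i) $$ (r, c) = (\<Sum>l<n. (B ^\<^sub>m i) $$ (r, l) * B $$ (l, c))"
      using mult_mat_nth[of "B ^\<^sub>m i" n B r c] Suc.prems B by simp
    also have "\<dots> \<le> (\<Sum>l<n. Y $$ (r, l) * B $$ (l, c))"
      using Suc B by (intro sum_mono mult_right_mono) (auto simp: mat_nonneg_iff)
    also have "\<dots> = (Y * B) $$ (r, c)"
      using mult_mat_nth[OF Y(1) B(1)] Suc.prems by simp
    also have "\<dots> \<le> Y $$ (r, c)" using Y_eq[OF Suc.prems] Suc.prems by simp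
    finally show ?case .
  qed
  have nonneg: "0 \<le> (B ^\<^sub>m i) $$ (r, c)" if "r < n" "c < n" for i r c
    using pow_mat_nonneg[OF B] that by (rule mat_nonnegD)
  \<comment> \<open>The sum of all entries of \<open>Y\<close> is a bound independent of the
    position.\<close>
  have "\<bar>(B ^\<^sub>m i) $$ (r, c)\<bar> \<le> (\<Sum>r<n. \<Sum>c<n. Y $$ (r, c))" if rc: "r < n" "c < n" for i r c
  proof -
    have Y0: "0 \<le> Y $$ (r, c)" if "r < n" "c < n" for r c using Y that by (simp add: mat_nonneg_iff)
    have "\<bar>(B ^\<^sub>m i) $$ (r, c)\<bar> \<le> Y $$ (r, c)" using bound[OF rc] nonneg[OF rc] by simp
    also have "\<dots> \<le> (\<Sum>c<n. Y $$ (r, c))"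
      using rc Y0 by (intro member_le_sum) auto
    also have "\<dots> \<le> (\<Sum>r<n. \<Sum>c<n. Y $$ (r, c))"
      using rc Y0 by (intro member_le_sum[where f = "\<lambda>r. \<Sum>c<n. Y $$ (r, c)"]) (auto intro!: sum_nonneg)
    finally show ?thesis .
  qed
  then show ?thesis unfolding power_bounded_def using B(1) by blast
qed

text \<open>The bound for powers comes from the Jordan normal form over the complex numbers; the
  embedding of the reals commutes with powers and preserves absolute values.\<close>

lemma power_bounded_of_spectral_radius:
  fixes C :: "real mat"
  assumes C: "C \<in> carrier_mat n n" and sr: "spectral_radius (map_mat complex_of_real C) < 1"
  shows "power_bounded n C"
proof -
  let ?C = "map_mat complex_of_real C"
  obtain K where K: "norm_bound (?C ^\<^sub>m k) K" for k
    using spectral_radius_jnf_norm_bound_less_1_upper_triangular[of ?C n] C sr by auto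
  have "\<bar>(C ^\<^sub>m k) $$ (r, c)\<bar> \<le> K" if "r < n" "c < n" for k r c
  proof -
    have eq: "?C ^\<^sub>m k = map_mat complex_of_real (C ^\<^sub>m k)"
      by (rule of_real_hom.mat_hom_pow[OF C, symmetric])
    show ?thesis using K[of k] that C unfolding eq norm_bound_def by simp
  qed
  then show ?thesis unfolding power_bounded_def using C by blast
qed

text \<open>The geometric series for \<open>(I - N / s)^(-1)\<close> is evaluated as
  \<open>1 / (1 - (r / s) t)\<close> at \<open>C = N / r\<close>, which fits the calculus for
  power-bounded matrices.\<close>

lemma Neumann_inverse_nonneg:
  fixes N :: "real mat"
  assumes n: "n \<ge> 1" and N: "N \<in> carrier_mat n n" "0\<^sub>m n n \<le> N"
    and s: "spectral_radius (map_mat complex_of_real N) < s"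
  obtains Y where "Y \<in> carrier_mat n n" "0\<^sub>m n n \<le> Y" "Y * (s \<cdot>\<^sub>m 1\<^sub>m n - N) = 1\<^sub>m n"
proof -
  let ?\<rho> = "spectral_radius (map_mat complex_of_real N)"
  have cN: "map_mat complex_of_real N \<in> carrier_mat n n" using N by simp
  have \<rho>: "0 \<le> ?\<rho>" using spectral_radius_mem_max(1)[OF cN] n by auto
  \<comment> \<open>Any value strictly between the spectral radius and \<open>s\<close> works: the
    lower gap makes \<open>C\<close> power-bounded, the upper gap makes the geometric coefficients
    summable.\<close>
  define r where "r = (?\<rho> + s) / 2"
  have r: "?\<rho> < r" "r < s" "0 < r" "0 < s" using \<rho> s by (auto simp: r_def)
  define C where "C = (1 / r) \<cdot>\<^sub>m N"
  have C: "C \<in> carrier_mat n n" "0\<^sub>m n n \<le> C" 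
    using N r by (auto simp: C_def less_eq_mat_def)
  have "map_mat complex_of_real C = complex_of_real (1 / r) \<cdot>\<^sub>m map_mat complex_of_real N"
    by (intro eq_matI) (auto simp: C_def)
  then have "spectral_radius (map_mat complex_of_real C) \<le> (1 / r) * ?\<rho>"
    using spectral_radius_smult_le[OF cN n, of "1 / r"] r by simp
  also have "\<dots> < 1" using r by (simp add: field_simps)
  finally have pb: "power_bounded n C" using C by (intro power_bounded_of_spectral_radius)
  have D: "s \<cdot>\<^sub>m 1\<^sub>m n - N \<in> carrier_mat n n" using N(1) by (rule minus_carrier_mat)
  define L where "L = 1 - fps_const (r / s) * fps_X"
  have L: "fps_nonneg (1 - L)" "L $ 0 = 1" "fps_abs_summable L"
    using r by (auto simp: L_def fps_nonneg_def fps_X_def intro!: fps_abs_summable_finite_support[of 1])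
  have "(\<Sum>i. L $ i) = 1 - r / s"
    by (subst suminf_finite[of "{..1}"]) (auto simp: L_def fps_X_def)
  then have L_inv: "fps_nonneg (inverse L)" "fps_abs_summable (inverse L)"
    using fps_nonneg_inverse[OF L(1,2)] fps_abs_summable_inverse[OF L] r by auto
  have "fps_mat n (inverse L) C * fps_mat n L C = fps_mat n (inverse L * L) C"
    by (rule fps_mat_mult[symmetric]) (use pb L L_inv in auto)
  also have "\<dots> = 1\<^sub>m n" using L C by (simp add: inverse_mult_eq_1 fps_mat_one)
  also have "fps_mat n L C = (1 / s) \<cdot>\<^sub>m (s \<cdot>\<^sub>m 1\<^sub>m n - N)"
  proof (rule eq_matI)
    fix i j assume "i < dim_row ((1 / s) \<cdot>\<^sub>m (s \<cdot>\<^sub>m 1\<^sub>m n - N))" "j < dim_col ((1 / s) \<cdot>\<^sub>m (s \<cdot>\<^sub>m 1\<^sub>m n - N))"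
    then have ij: "i < n" "j < n" using N by auto
    have "fps_mat n L C $$ (i, j) = (\<Sum>k\<le>1. L $ k * (C ^\<^sub>m k) $$ (i, j))"
      using ij by (intro fps_mat_nth_finite) (auto simp: L_def fps_X_def)
    then show "fps_mat n L C $$ (i, j) = ((1 / s) \<cdot>\<^sub>m (s \<cdot>\<^sub>m 1\<^sub>m n - N)) $$ (i, j)"
      using ij N C r by (simp add: L_def C_def field_simps)
  qed (use N in auto)
  also have "fps_mat n (inverse L) C * ((1 / s) \<cdot>\<^sub>m (s \<cdot>\<^sub>m 1\<^sub>m n - N))
     = ((1 / s) \<cdot>\<^sub>m fps_mat n (inverse L) C) * (s \<cdot>\<^sub>m 1\<^sub>m n - N)"
    using mult_smult_distrib[OF fps_mat_carrier D] mult_smult_assoc_mat[OF fps_mat_carrier D] by simp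
  finally have "((1 / s) \<cdot>\<^sub>m fps_mat n (inverse L) C) * (s \<cdot>\<^sub>m 1\<^sub>m n - N) = 1\<^sub>m n" .
  moreover have "0\<^sub>m n n \<le> (1 / s) \<cdot>\<^sub>m fps_mat n (inverse L) C"
    using fps_mat_nonneg[OF pb C(2) L_inv(2,1)] r by (auto simp: less_eq_mat_def)
  ultimately show thesis by (intro that[of "(1 / s) \<cdot>\<^sub>m fps_mat n (inverse L) C"]) auto
qed

text \<open>Nonnegativity of \<open>I - A\<close> comes from \<open>N\<close> off the diagonal and
  from the bound 1 on it. The value of \<open>s\<close> is not controlled, so bounded powers are
  derived from the nonnegative inverse of \<open>A\<close> instead of from the spectral radius of
  \<open>N\<close>.\<close>

lemma M1_residual:
  assumes n: "n \<ge> 1" and A: "A \<in> M1 n"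
  shows "A \<in> carrier_mat n n" "0\<^sub>m n n \<le> 1\<^sub>m n - A" "power_bounded n (1\<^sub>m n - A)"
proof -
  obtain s N where N: "N \<in> carrier_mat n n" "0\<^sub>m n n \<le> N" and A_eq: "A = s \<cdot>\<^sub>m 1\<^sub>m n - N"
    and s: "spectral_radius (map_mat complex_of_real N) < s"
    using A unfolding M1_def nonsingular_M_matrix_def by blast
  obtain Y where Y: "Y \<in> carrier_mat n n" "0\<^sub>m n n \<le> Y" "Y * A = 1\<^sub>m n"
    using Neumann_inverse_nonneg[OF n N s] unfolding A_eq by blast
  show cA: "A \<in> carrier_mat n n" using N by (simp add: A_eq minus_carrier_mat)
  have B: "1\<^sub>m n - A \<in> carrier_mat n n" using cA by (rule minus_carrier_mat)
  have "0 \<le> (1\<^sub>m n - A) $$ (r, c)" if "r < n" "c < n" for r c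
    using that A N cA unfolding M1_def
    by (cases "r = c") (auto simp: A_eq mat_nonneg_iff)
  then show nonneg: "0\<^sub>m n n \<le> 1\<^sub>m n - A" using B by (simp add: mat_nonneg_iff)
  have "1\<^sub>m n - (1\<^sub>m n - A) = A" using cA by (intro eq_matI) auto
  then show "power_bounded n (1\<^sub>m n - A)"
    using power_bounded_of_inverse_nonneg[OF B nonneg Y(1,2)] Y(3) by simp
qed

section \<open>The invariant of the iteration\<close>

context schroeder
begin

text \<open>The clause X B \<ge> 0 is the one that propagates: X' B' = X T(B) f(B) = X h(B) is a nonnegative
  combination of the matrices X B^i with i > 0.\<close>
definition schroeder_inv :: "nat \<Rightarrow> real mat \<Rightarrow> real mat \<Rightarrow> real mat \<Rightarrow> real mat \<Rightarrow> bool" where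
  "schroeder_inv n A X W B \<longleftrightarrow>
     X \<in> carrier_mat n n \<and> 0\<^sub>m n n \<le> 1\<^sub>m n - X \<and>
     W \<in> carrier_mat n n \<and> 0\<^sub>m n n \<le> W \<and> X * W = 1\<^sub>m n \<and> W * X = 1\<^sub>m n \<and> A * W = W * A \<and>
     power_bounded n B \<and> 0\<^sub>m n n \<le> B \<and> B = 1\<^sub>m n - A * W ^\<^sub>m p \<and> 0\<^sub>m n n \<le> X * B"

lemma schroeder_T_eq:
  assumes "B \<in> carrier_mat n n"
  shows "schroeder_T p m B = fps_mat n T B"
proof (rule eq_matI)
  fix r c assume "r < dim_row (fps_mat n T B)" "c < dim_col (fps_mat n T B)"
  then have rc: "r < n" "c < n" by auto
  have "fps_mat n T B $$ (r, c) = (\<Sum>i\<le>m. T $ i * (B ^\<^sub>m i) $$ (r, c))"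
    using rc by (intro fps_mat_nth_finite) (auto simp: T_def)
  then show "schroeder_T p m B $$ (r, c) = fps_mat n T B $$ (r, c)"
    using rc assms by (simp add: schroeder_T_def T_def)
qed (use assms in \<open>auto simp: schroeder_T_def\<close>)

lemma schroeder_R_eq:
  assumes "schroeder_inv n A X W B" "A \<in> carrier_mat n n"
  shows "schroeder_R p A X = B"
  using assms mat_inverse_eqI[of X n W] by (auto simp: schroeder_inv_def schroeder_R_def)

text \<open>The new residual is \<open>f(B) = I - (I - B) V(B)^p = I - A W^p V(B)^p\<close>; because
  \<open>W\<close> commutes with \<open>V(B)\<close>, the last product is \<open>A\<close> times the
  \<open>p\<close>th power of the new inverse \<open>V(B) W\<close>.\<close>

lemma schroeder_inv_step:
  assumes A: "A \<in> carrier_mat n n" and inv: "schroeder_inv n A X W B"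
  shows "schroeder_inv n A (X * fps_mat n T B) (fps_mat n V B * W) (fps_mat n f B)"
proof -
  let ?T = "fps_mat n T B" and ?V = "fps_mat n V B" and ?f = "fps_mat n f B"
  have X: "X \<in> carrier_mat n n" "0\<^sub>m n n \<le> 1\<^sub>m n - X"
    and W: "W \<in> carrier_mat n n" "0\<^sub>m n n \<le> W" "X * W = 1\<^sub>m n" "W * X = 1\<^sub>m n" "A * W = W * A"
    and B: "power_bounded n B" "0\<^sub>m n n \<le> B" "B = 1\<^sub>m n - A * W ^\<^sub>m p" "0\<^sub>m n n \<le> X * B"
    using inv unfolding schroeder_inv_def by auto
  note cB = power_bounded_carrier[OF B(1)]
  have TV: "?T * ?V = 1\<^sub>m n"
    unfolding fps_mat_mult[OF B(1) T_summable V_summable, symmetric] T_V using cB by (rule fps_mat_one)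
  have VT: "?V * ?T = 1\<^sub>m n"
    unfolding fps_mat_mult[OF B(1) V_summable T_summable, symmetric] mult.commute[of V] T_V
    using cB by (rule fps_mat_one)
  have Wp: "W ^\<^sub>m p \<in> carrier_mat n n" using W by simp
  \<comment> \<open>\<open>B\<close> is a polynomial expression in \<open>A\<close> and
    \<open>W\<close>, so whatever commutes with both commutes with \<open>B\<close> and, through
    \<open>fps_mat_commute\<close>, with \<open>V(B)\<close>.\<close>
  have com: "B * Z = Z * B" if Z: "Z \<in> carrier_mat n n" "A * Z = Z * A" "W * Z = Z * W" for Z
  proof -
    have "A * W ^\<^sub>m p * Z = A * (W ^\<^sub>m p * Z)" by (rule assoc_mult_mat[OF A Wp Z(1)])
    also have "\<dots> = A * Z * W ^\<^sub>m p"
      unfolding pow_mat_commute[OF W(1) Z(1,3)] by (rule assoc_mult_mat[OF A Z(1) Wp, symmetric])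
    also have "\<dots> = Z * (A * W ^\<^sub>m p)" unfolding Z(2) by (rule assoc_mult_mat[OF Z(1) A Wp])
    finally have eq: "A * W ^\<^sub>m p * Z = Z * (A * W ^\<^sub>m p)" .
    have AW: "A * W ^\<^sub>m p \<in> carrier_mat n n" using A Wp by simp
    show ?thesis
      unfolding B(3) minus_mult_distrib_mat[OF one_carrier_mat AW Z(1)]
        mult_minus_distrib_mat[OF Z(1) one_carrier_mat AW] eq using Z by simp
  qed
  have BW: "B * W = W * B" by (rule com[OF W(1,5) refl])
  have BA: "B * A = A * B" by (rule com[OF A refl W(5)[symmetric]])
  have VA: "?V * A = A * ?V" by (rule fps_mat_commute[OF B(1) V_summable A BA])
  have VW: "?V * W = W * ?V" by (rule fps_mat_commute[OF B(1) V_summable W(1) BW])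
  show ?thesis unfolding schroeder_inv_def
  proof (intro conjI)
    show "X * ?T \<in> carrier_mat n n" using X by simp
    show "?V * W \<in> carrier_mat n n" by (rule mult_carrier_mat[OF fps_mat_carrier W(1)])
    show "0\<^sub>m n n \<le> ?V * W"
      by (intro mult_mat_nonneg fps_mat_nonneg B V_summable V_nonneg W) auto
    show "X * ?T * (?V * W) = 1\<^sub>m n"
    proof -
      have "X * ?T * (?V * W) = X * (?T * ?V) * W"
        using X(1) W(1) by (simp add: assoc_mult_mat[of _ n n _ n _ n] mult_carrier_mat[of _ n n _ n])
      then show ?thesis using X(1) W(3) TV by simp
    qed
    show "?V * W * (X * ?T) = 1\<^sub>m n"
    proof -
      have "?V * W * (X * ?T) = ?V * (W * X) * ?T"
        using X(1) W(1) by (simp add: assoc_mult_mat[of _ n n _ n _ n] mult_carrier_mat[of _ n n _ n])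
      then show ?thesis using W(4) VT by simp
    qed
    show "A * (?V * W) = ?V * W * A"
    proof -
      have "A * (?V * W) = (A * ?V) * W" using A W(1) by (simp add: assoc_mult_mat[of _ n n _ n _ n] mult_carrier_mat[of _ n n _ n])
      also have "\<dots> = ?V * (A * W)" unfolding VA[symmetric] using A W(1) by (simp add: assoc_mult_mat[of _ n n _ n _ n] mult_carrier_mat[of _ n n _ n])
      finally show ?thesis unfolding W(5) using A W(1) by (simp add: assoc_mult_mat[of _ n n _ n _ n] mult_carrier_mat[of _ n n _ n])
    qed
    show "power_bounded n ?f"
      by (rule power_bounded_fps_mat[OF B(1) f_nonneg f_summable f_sums])
    show "0\<^sub>m n n \<le> ?f" by (rule fps_mat_nonneg[OF B(1,2) f_summable f_nonneg])
    show "?f = 1\<^sub>m n - A * (?V * W) ^\<^sub>m p"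
    proof -
      have "?f = 1\<^sub>m n - (1\<^sub>m n - B) * ?V ^\<^sub>m p"
        unfolding f_def using cB
        by (simp add: fps_mat_diff[OF B(1)] fps_mat_mult[OF B(1)] fps_mat_power[OF B(1)] fps_mat_one fps_mat_X
          fps_abs_summable_one fps_abs_summable_X V_summable fps_abs_summable_power fps_abs_summable_mult one_minus_X_summable)
      also have "1\<^sub>m n - B = A * W ^\<^sub>m p"
        using A Wp unfolding B(3) by (intro eq_matI) auto
      also have "A * W ^\<^sub>m p * ?V ^\<^sub>m p = A * (?V * W) ^\<^sub>m p"
        unfolding VW pow_mat_mult_distrib[OF W(1) fps_mat_carrier VW[symmetric]]
        using A Wp by (intro assoc_mult_mat) auto
      finally show ?thesis .
    qed
    show "0\<^sub>m n n \<le> X * ?T * ?f"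
    proof -
      have "h $ 0 = 0" by (rule h_order) simp
      have "X * ?T * ?f = X * fps_mat n h B"
        unfolding h_eq fps_mat_mult[OF B(1) T_summable f_summable]
        using X by (intro assoc_mult_mat) auto
      then show ?thesis
        using mult_fps_mat_nonneg[OF B(1,2) h_summable h_nonneg \<open>h $ 0 = 0\<close> X(1) B(4)] by simp
    qed
    show "0\<^sub>m n n \<le> 1\<^sub>m n - X * ?T"
    proof -
      have s: "fps_abs_summable (1 - T)" by (intro fps_abs_summable_diff fps_abs_summable_one T_summable)
      \<comment> \<open>\<open>X\<close> may have negative entries off the diagonal, but
        \<open>1 - T\<close> has no constant term, so \<open>X B >= 0\<close> gives the sign of
        \<open>X - X T(B)\<close>.\<close>
      have "0\<^sub>m n n \<le> X * fps_mat n (1 - T) B"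
        by (rule mult_fps_mat_nonneg[OF B(1,2) s one_minus_T_nonneg _ X(1) B(4)]) (simp add: T_0)
      also have "X * fps_mat n (1 - T) B = X - X * ?T"
        using mult_minus_distrib_mat[OF X(1) one_carrier_mat fps_mat_carrier] X
        by (simp add: fps_mat_diff[OF B(1) fps_abs_summable_one T_summable] fps_mat_one[OF cB])
      finally have "X * ?T \<le> X" using X(1) by (auto simp: less_eq_mat_def simp del: index_mult_mat(1))
      also have "X \<le> 1\<^sub>m n" using X by (simp add: less_eq_mat_def)
      finally show ?thesis using X(1) by (auto simp: less_eq_mat_def simp del: index_mult_mat(1))
    qed
  qed
qed

lemma schroeder_iter_inv:
  assumes "n \<ge> 1" "A \<in> M1 n"
  shows "\<exists>W B. schroeder_inv n A (schroeder_iter p m A k) W B"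
proof (induction k)
  case 0
  note A = M1_residual[OF assms]
  have B: "1\<^sub>m n - A \<in> carrier_mat n n" using A(1) by (rule minus_carrier_mat)
  have [simp]: "1\<^sub>m n ^\<^sub>m p = (1\<^sub>m n :: real mat)" by (induction p) auto
  \<comment> \<open>With \<open>X = W = I\<close> the residual is \<open>I - A\<close>, and the
    clause \<open>X B >= 0\<close> becomes \<open>I - A >= 0\<close>.\<close>
  have "schroeder_inv n A (1\<^sub>m n) (1\<^sub>m n) (1\<^sub>m n - A)"
    unfolding schroeder_inv_def using A B by (auto simp: one_mat_nonneg less_eq_mat_def)
  then show ?case using A(1) by auto
next
  case (Suc k)
  note A = M1_residual(1)[OF assms]
  from Suc obtain W B where inv: "schroeder_inv n A (schroeder_iter p m A k) W B" by blast
  then have "B \<in> carrier_mat n n" by (auto simp: schroeder_inv_def power_bounded_def)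
  with schroeder_inv_step[OF A inv] show ?case
    unfolding schroeder_iter.simps schroeder_R_eq[OF inv A] by (auto simp: schroeder_T_eq)
qed

end

theorem corollary10:
  fixes n p m :: nat and A :: "real mat"
  assumes "n \<ge> 1" and "p \<ge> 2" and "m \<ge> 1"
    and "A \<in> M1 n"
  shows "\<forall>k. schroeder_iter p m A k \<in> M1 n"
proof
  fix k
  interpret schroeder p m by unfold_locales fact
  show "schroeder_iter p m A k \<in> M1 n"
    using schroeder_iter_inv[OF assms(1,4), of k] M1_I_inverse_nonneg[OF assms(1)]
    unfolding schroeder_inv_def by blast
qed

end
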